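(* For every integer $k \ge 1$ there is a constant $c_1 > 0$ (depending only on $k$) such that for every integer $n \ge 2$, $$\overrightarrow{r}(\overrightarrow{P_n}, k+1) \ \ge\ c_1\, n^{2k} (\log n)^{2/(k+1)}.$$
   Context: Graphs are finite. An oriented graph is a directed graph without loops such that for every two vertices $x, y$ at most one of $xy$ and $yx$ is an edge. $\overrightarrow{P_n}$ denotes the directed path on $n$ vertices, i.e. the oriented graph with vertices $v_1, \ldots, v_n$ and edges $v_i v_{i+1}$ for $1 \le i \le n-1$. For an oriented graph $H$ and an integer $q \ge 1$, the $q$-colour oriented size Ramsey number $\overrightarrow{r}(H, q)$ is the minimum $m$ for which there exists an oriented graph $G$ with $m$ edges such that every colouring of the edges of $G$ with $q$ colours contains a monochromatic copy of $H$ (as a not necessarily induced subgraph, with orientations preserved). All logarithms are in base $2$. *)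

theory Defs
  imports Complex_Main "Graph_Theory.Pair_Digraph"
begin

definition oriented_graph :: "'a pair_pre_digraph \<Rightarrow> bool" where
  "oriented_graph G \<longleftrightarrow>
     pair_digraph G \<and> (\<forall>x y. (x, y) \<in> parcs G \<longrightarrow> (y, x) \<notin> parcs G)"

definition directed_path :: "nat \<Rightarrow> nat pair_pre_digraph" where
  "directed_path n = \<lparr> pverts = {1..n}, parcs = {(i, i + 1) | i. 1 \<le> i \<and> i < n} \<rparr>"

definition contains_copy :: "'b pair_pre_digraph \<Rightarrow> 'a pair_pre_digraph \<Rightarrow> bool" where
  "contains_copy G H \<longleftrightarrow>
     (\<exists>f. inj_on f (pverts H) \<and> f ` pverts H \<subseteq> pverts G \<and>
          (\<forall>u v. (u, v) \<in> parcs H \<longrightarrow> (f u, f v) \<in> parcs G))"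

definition colour_class ::
  "'b pair_pre_digraph \<Rightarrow> ('b \<times> 'b \<Rightarrow> nat) \<Rightarrow> nat \<Rightarrow> 'b pair_pre_digraph" where
  "colour_class G c j = \<lparr> pverts = pverts G, parcs = {e \<in> parcs G. c e = j} \<rparr>"

definition arrows :: "'b pair_pre_digraph \<Rightarrow> 'a pair_pre_digraph \<Rightarrow> nat \<Rightarrow> bool" where
  "arrows G H q \<longleftrightarrow>
     (\<forall>c. (\<forall>e \<in> parcs G. c e < q) \<longrightarrow> (\<exists>j<q. contains_copy (colour_class G c j) H))"

(* Every finite graph is isomorphic to one with vertices in nat, so letting G range over
   graphs on nat loses nothing. The minimum is over a nonempty set for directed paths and
   q >= 1 (a sufficiently large transitive tournament G works); if no G works for H, as
   happens when q >= 2 and H has a directed cycle, the value is unspecified. *)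
definition oriented_size_ramsey :: "'a pair_pre_digraph \<Rightarrow> nat \<Rightarrow> nat" where
  "oriented_size_ramsey H q =
     (LEAST m. \<exists>G :: nat pair_pre_digraph.
        oriented_graph G \<and> card (parcs G) = m \<and> arrows G H q)"

end

(* Suppose the arcs of G split the vertices into t classes, each consisting of L layers with all
   inner arcs going upwards. Placing the classes on a grid with k coordinates and the layers on one
   with k+1 coordinates gives a (k+1)-colouring whose monochromatic paths have at most about
   k t^(1/k) L^(1/(k+1)) vertices. It therefore suffices to show that, for D = n^k (log n)^(1/(k+1)),
   every oriented graph with at most c D^2 arcs has such a partition with L <= log D and t a small
   multiple of D / log D. On vertex sets smaller than a multiple of D one repeatedly removes
   transitive sets of logarithmic size. On a larger set of N vertices the arc density is
   1/K = O(D^2/N^2), and one can remove layered sets of size of order K^(3/4) log D: if a maximum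
   layered set X were smaller, then typical vertices would have few neighbours in X, so many vertices
   would have the same neighbourhood Y in X, and replacing Y by a transitive subset of these vertices
   would enlarge X. Since 3/4 > 1/2, the number of steps sums to O(D / log D) without a loss of
   log log factors. *)
theory Submission
  imports Defs "HOL-Library.Ramsey" "HOL-Real_Asymp.Real_Asymp"
begin

section \<open>Layered sets\<close>

text \<open>A height function for the induced digraph: such an \<open>X\<close> induces an acyclic
  digraph whose directed paths have at most \<open>L\<close> vertices. The size of a layer is
  unrestricted, so \<open>X\<close> may be far larger than \<open>L\<close>.\<close>

definition layered :: "('a \<times> 'a) set \<Rightarrow> 'a set \<Rightarrow> nat \<Rightarrow> bool" where
  "layered E X L \<longleftrightarrow>
     (\<exists>h. (\<forall>x\<in>X. h x < L) \<and> (\<forall>x\<in>X. \<forall>y\<in>X. (x, y) \<in> E \<longrightarrow> h x < h y))"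

definition nbrs :: "('a \<times> 'a) set \<Rightarrow> 'a set \<Rightarrow> 'a \<Rightarrow> 'a set" where
  "nbrs E S v = {w \<in> S. (v, w) \<in> E \<or> (w, v) \<in> E}"

lemma layered_empty [simp]: "layered E {} L"
  by (simp add: layered_def)

lemma layered_mono:
  assumes "layered E X L" "L \<le> L'"
  shows "layered E X L'"
proof -
  obtain h where "\<forall>x\<in>X. h x < L" "\<forall>x\<in>X. \<forall>y\<in>X. (x, y) \<in> E \<longrightarrow> h x < h y"
    using assms(1) by (auto simp: layered_def)
  with assms(2) show ?thesis
    unfolding layered_def by (intro exI[of _ h]) auto
qed

lemma layered_subset: "layered E X L \<Longrightarrow> Y \<subseteq> X \<Longrightarrow> layered E Y L"
  unfolding layered_def by blast

lemma layered_Un: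
  assumes "layered E X L" "layered E Y L"
    and "\<And>x y. x \<in> X \<Longrightarrow> y \<in> Y \<Longrightarrow> (x, y) \<notin> E \<and> (y, x) \<notin> E"
  shows "layered E (X \<union> Y) L"
proof -
  obtain h where h: "\<forall>x\<in>X. h x < L" "\<forall>x\<in>X. \<forall>y\<in>X. (x, y) \<in> E \<longrightarrow> h x < h y"
    using assms(1) by (auto simp: layered_def)
  obtain g where g: "\<forall>x\<in>Y. g x < L" "\<forall>x\<in>Y. \<forall>y\<in>Y. (x, y) \<in> E \<longrightarrow> g x < g y"
    using assms(2) by (auto simp: layered_def)
  show ?thesis
    unfolding layered_def
    by (rule exI[of _ "\<lambda>x. if x \<in> X then h x else g x"]) (use h g assms(3) in auto)
qed

text \<open>The halving argument for transitive subtournaments: by asymmetry each vertex other than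
  \<open>v\<close> can lie above \<open>v\<close> (the set \<open>A\<close>) or below it (the set
  \<open>B\<close>), so one of the two has at least \<open>2 ^ r\<close> elements, and
  \<open>v\<close> becomes the bottom or the top of the set found there.\<close>

lemma layered_of_card:
  assumes "asym E" "finite M" "2 ^ r \<le> card M"
  shows "\<exists>T\<subseteq>M. card T = r \<and> layered E T r"
proof -
  have asym: "(x, y) \<notin> E \<or> (y, x) \<notin> E" for x y
    using assms(1) by (blast dest: asymD)
  then have irrefl: "(x, x) \<notin> E" for x by blast
  show ?thesis
    using assms(2,3)
  proof (induction r arbitrary: M)
    case 0
    then show ?case by (intro exI[of _ "{}"]) auto
  next
    case (Suc r)
    have "M \<noteq> {}" using Suc.prems(2) by auto
    then obtain v where v: "v \<in> M" by blast
    define A where "A = {u \<in> M - {v}. (u, v) \<notin> E}"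
    define B where "B = {u \<in> M - {v}. (v, u) \<notin> E}"
    have "M - {v} = A \<union> B"
      unfolding A_def B_def using asym[of _ v] by blast
    then have "card (M - {v}) \<le> card A + card B"
      by (simp add: card_Un_le)
    moreover have "card (M - {v}) = card M - 1" using v Suc.prems by simp
    ultimately have "2 ^ r \<le> card A \<or> 2 ^ r \<le> card B"
      using Suc.prems(2) by (simp, linarith)
    then show ?case
    proof
      assume "2 ^ r \<le> card A"
      with Suc.IH[of A] Suc.prems obtain T where T: "T \<subseteq> A" "card T = r" "layered E T r"
        by (auto simp: A_def)
      then obtain h where h: "\<forall>x\<in>T. h x < r" "\<forall>x\<in>T. \<forall>y\<in>T. (x, y) \<in> E \<longrightarrow> h x < h y"
        by (auto simp: layered_def)
      have "finite T" using T Suc.prems(1) by (auto simp: A_def intro: finite_subset)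
      have vT: "v \<notin> T" using T by (auto simp: A_def)
      have "layered E (insert v T) (Suc r)"
        unfolding layered_def
        by (rule exI[of _ "\<lambda>x. if x = v then 0 else Suc (h x)"])
          (use h T asym[of _ v] irrefl in \<open>auto simp: A_def\<close>)
      with T v vT \<open>finite T\<close> show ?thesis
        by (intro exI[of _ "insert v T"]) (auto simp: A_def)
    next
      assume "2 ^ r \<le> card B"
      with Suc.IH[of B] Suc.prems obtain T where T: "T \<subseteq> B" "card T = r" "layered E T r"
        by (auto simp: B_def)
      then obtain h where h: "\<forall>x\<in>T. h x < r" "\<forall>x\<in>T. \<forall>y\<in>T. (x, y) \<in> E \<longrightarrow> h x < h y"
        by (auto simp: layered_def)
      have "finite T" using T Suc.prems(1) by (auto simp: B_def intro: finite_subset)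
      have vT: "v \<notin> T" using T by (auto simp: B_def)
      have "layered E (insert v T) (Suc r)"
        unfolding layered_def
        by (rule exI[of _ "\<lambda>x. if x = v then r else h x"])
          (use h T asym[of _ v] irrefl in \<open>auto simp: B_def less_Suc_eq\<close>)
      with T v vT \<open>finite T\<close> show ?thesis
        by (intro exI[of _ "insert v T"]) (auto simp: B_def)
    qed
  qed
qed

section \<open>Degree counting and shared neighbourhoods\<close>

lemma finite_nbrs: "finite S \<Longrightarrow> finite (nbrs E S v)"
  by (simp add: nbrs_def)

lemma card_nbrs_eq_sum:
  assumes "finite S"
  shows "card (nbrs E S v) = (\<Sum>w\<in>S. if (v, w) \<in> E \<or> (w, v) \<in> E then 1 else 0)"
  using sum.inter_filter[OF assms, of "\<lambda>_. 1::nat" "\<lambda>w. (v, w) \<in> E \<or> (w, v) \<in> E"]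
  by (simp add: nbrs_def)

lemma sum_card_nbrs_swap:
  assumes "finite U" "finite X"
  shows "(\<Sum>v\<in>U. card (nbrs E X v)) = (\<Sum>w\<in>X. card (nbrs E U w))"
  unfolding card_nbrs_eq_sum[OF assms(1)] card_nbrs_eq_sum[OF assms(2)]
  by (subst sum.swap) (simp only: disj_commute)

lemma sum_card_nbrs_le:
  assumes "finite U" "finite E"
  shows "(\<Sum>v\<in>U. card (nbrs E U v)) \<le> 2 * card E"
proof -
  have "(\<Sum>v\<in>U. card (nbrs E U v)) = card (SIGMA v:U. nbrs E U v)"
    using assms by (simp add: finite_nbrs)
  also have "\<dots> \<le> card (E \<union> prod.swap ` E)"
  proof (rule card_mono)
    show "(SIGMA v:U. nbrs E U v) \<subseteq> E \<union> prod.swap ` E"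
    proof
      fix p assume "p \<in> (SIGMA v:U. nbrs E U v)"
      then obtain v w where "p = (v, w)" "(v, w) \<in> E \<or> (w, v) \<in> E"
        by (auto simp: nbrs_def)
      then show "p \<in> E \<union> prod.swap ` E"
        using image_eqI[of "(v, w)" prod.swap "(w, v)" E] by auto
    qed
  qed (use assms in auto)
  also have "\<dots> \<le> card E + card (prod.swap ` E)"
    by (rule card_Un_le)
  also have "\<dots> \<le> 2 * card E"
    using card_image_le[OF assms(2), of prod.swap] by simp
  finally show ?thesis .
qed

text \<open>Markov's inequality for the counting measure on \<open>U\<close>.\<close>

lemma card_large_values_le:
  fixes f :: "'a \<Rightarrow> nat"
  assumes "finite U" "real (\<Sum>v\<in>U. f v) \<le> a * b" "0 \<le> a" "0 < b"
  shows "real (card {v\<in>U. real (f v) > b}) \<le> a"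
proof -
  have "real (card {v\<in>U. real (f v) > b}) * b = (\<Sum>v\<in>{v\<in>U. real (f v) > b}. b)"
    by simp
  also have "\<dots> \<le> (\<Sum>v\<in>{v\<in>U. real (f v) > b}. real (f v))"
    by (rule sum_mono) auto
  also have "\<dots> \<le> (\<Sum>v\<in>U. real (f v))"
    by (rule sum_mono2) (use assms in auto)
  also have "\<dots> \<le> a * b" using assms by simp
  finally show ?thesis using assms by simp
qed

lemma card_small_values_ge:
  fixes f :: "'a \<Rightarrow> nat"
  assumes "finite U" "real (\<Sum>v\<in>U. f v) \<le> a * b" "0 \<le> a" "0 < b"
  shows "real (card U) - a \<le> real (card {v\<in>U. real (f v) \<le> b})"
proof -
  have "card U = card ({v\<in>U. real (f v) > b} \<union> {v\<in>U. real (f v) \<le> b})"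
    by (rule arg_cong[of _ _ card]) auto
  also have "\<dots> = card {v\<in>U. real (f v) > b} + card {v\<in>U. real (f v) \<le> b}"
    by (rule card_Un_disjoint) (use assms in auto)
  finally show ?thesis using card_large_values_le[OF assms] by linarith
qed

text \<open>Weighting a trace of size \<open>j\<close> by \<open>\<theta>\<^sup>j\<close> gives all traces on \<open>X\<close> a total weight of
  \<open>(1 + \<theta>)\<^bsup>|X|\<^esup> \<le> exp (\<theta> |X|)\<close>; this is much better than the uniform pigeonhole principle,
  as only traces of size at most \<open>\<theta> |X|\<close> occur.\<close>
lemma popular_trace:
  fixes \<theta> :: real
  assumes "finite X" "finite Z" "0 < \<theta>" "\<theta> \<le> 1"
    and "\<And>v. v \<in> Z \<Longrightarrow> t v \<subseteq> X \<and> real (card (t v)) \<le> \<theta> * card X"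
  shows "\<exists>Y\<subseteq>X. real (card Z) * (\<theta> / exp 1) powr (\<theta> * card X) \<le> real (card {v\<in>Z. t v = Y})"
proof (rule ccontr)
  assume contr: "\<not> ?thesis"
  define y where "y = \<theta> * card X"
  define M where "M = real (card Z) * (\<theta> / exp 1) powr y"
  have less: "real (card {v\<in>Z. t v = Y}) < M" if "Y \<subseteq> X" for Y
    using contr that by (auto simp: not_le M_def y_def)
  have "card Z * \<theta> powr y = (\<Sum>v\<in>Z. \<theta> powr y)" by simp
  also have "\<dots> \<le> (\<Sum>v\<in>Z. \<theta> ^ card (t v))"
  proof (rule sum_mono)
    fix v assume "v \<in> Z"
    then have "\<theta> powr y \<le> \<theta> powr (card (t v))"
      using assms by (intro powr_mono') (auto simp: y_def)
    then show "\<theta> powr y \<le> \<theta> ^ card (t v)"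
      using assms by (simp add: powr_realpow)
  qed
  also have "\<dots> = (\<Sum>Y\<in>Pow X. \<Sum>v\<in>{v\<in>Z. t v = Y}. \<theta> ^ card (t v))"
    by (rule sum.group[symmetric]) (use assms in auto)
  also have "\<dots> = (\<Sum>Y\<in>Pow X. real (card {v\<in>Z. t v = Y}) * \<theta> ^ card Y)"
    by (intro sum.cong) auto
  also have "\<dots> < (\<Sum>Y\<in>Pow X. M * \<theta> ^ card Y)"
    by (intro sum_strict_mono mult_strict_right_mono less) (use assms in auto)
  also have "\<dots> = M * (\<Sum>Y\<in>Pow X. \<theta> ^ card Y)"
    by (simp add: sum_distrib_left)
  also have "(\<Sum>Y\<in>Pow X. \<theta> ^ card Y) = (1 + \<theta>) ^ card X"
    using prod_add[OF assms(1), of "\<lambda>_. \<theta>" "\<lambda>_. 1"] by (simp add: add.commute)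
  \<comment> \<open>The factor \<open>exp y\<close> is cancelled by the \<open>exp 1\<close> in the
    base \<open>\<theta> / exp 1\<close> of \<open>M\<close>.\<close>
  also have "M * (1 + \<theta>) ^ card X \<le> M * exp y"
  proof (rule mult_left_mono)
    have "(1 + \<theta>) ^ card X \<le> exp \<theta> ^ card X"
      using assms by (intro power_mono) auto
    then show "(1 + \<theta>) ^ card X \<le> exp y"
      by (simp add: y_def exp_of_nat_mult[symmetric] mult.commute)
  qed (simp add: M_def)
  also have "\<dots> = card Z * \<theta> powr y"
    using assms by (simp add: M_def powr_divide exp_powr_real)
  finally show False by simp
qed

text \<open>The three conditions on \<open>s\<close> serve the exchange in a maximum layered set
  \<open>X\<close> with fewer than \<open>s\<close> elements: the first leaves half of
  \<open>U\<close> available outside \<open>X\<close>, the second lets the new transitive set fit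
  into \<open>L\<close> layers, and the third makes the most popular trace common enough to contain
  such a set.\<close>

lemma layered_of_sparse:
  fixes \<theta> s :: real
  assumes "asym E" "finite U" "0 < \<theta>" "\<theta> \<le> 1" "0 < s"
    and deg: "\<And>v. v \<in> U \<Longrightarrow> real (card (nbrs E U v)) \<le> \<theta> * card U / 4"
    and s: "s \<le> card U / 4" "\<theta> * s + 1 \<le> real L"
      "4 * (2 * exp 1 / \<theta>) powr (\<theta> * s) \<le> card U"
  shows "\<exists>X\<subseteq>U. layered E X L \<and> s \<le> real (card X)"
proof -
  define P where "P = (\<lambda>X. X \<subseteq> U \<and> layered E X L)"
  have "P {}" by (simp add: P_def)
  moreover have "\<forall>X. P X \<longrightarrow> card X < Suc (card U)"
    using assms(2) by (auto simp: P_def less_Suc_eq_le card_mono)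
  ultimately obtain X where "P X" and max: "\<And>X'. P X' \<Longrightarrow> card X' \<le> card X"
    using ex_has_greatest_nat[of P "{}" card "Suc (card U)"] by (metis)
  then have X: "X \<subseteq> U" "layered E X L" by (auto simp: P_def)
  have "finite X" using X assms finite_subset by blast
  show ?thesis
  proof (cases "s \<le> real (card X)")
    case True
    then show ?thesis using X by blast
  next
    case False
    define y where "y = \<theta> * card X"
    define N where "N = real (card U)"
    define W where "W = {v\<in>U. real (card (nbrs E X v)) \<le> y}"
    have "y \<le> \<theta> * s" using False assms by (simp add: y_def)
    have "N > 0" using s(1) \<open>0 < s\<close> by (simp add: N_def)
    \<comment> \<open>Double counting bounds the sum of all traces by
      \<open>card X * (\<theta> * N / 4)\<close>, which is \<open>N / 4 * y\<close>. The empty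
      \<open>X\<close> is separate because Markov's inequality needs a positive threshold.\<close>
    have "N - N / 4 \<le> card W"
    proof (cases "card X = 0")
      case True
      then have "X = {}" using \<open>finite X\<close> by simp
      then have "W = U" by (auto simp: W_def nbrs_def y_def)
      then show ?thesis by (simp add: N_def)
    next
      case False
      have "real (\<Sum>v\<in>U. card (nbrs E X v)) = (\<Sum>w\<in>X. real (card (nbrs E U w)))"
        by (simp add: sum_card_nbrs_swap[OF assms(2) \<open>finite X\<close>])
      also have "\<dots> \<le> (\<Sum>w\<in>X. \<theta> * N / 4)"
        using deg X by (intro sum_mono) (auto simp: N_def)
      also have "\<dots> = N / 4 * y"
        by (simp add: y_def)
      finally show ?thesis
        using card_small_values_ge[OF assms(2), of "\<lambda>v. card (nbrs E X v)" "N/4" y] False assms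
        by (auto simp: W_def y_def N_def)
    qed
    moreover have "card W \<le> card (W - X) + card X"
    proof -
      have "card W \<le> card ((W - X) \<union> X)"
        using \<open>finite X\<close> \<open>finite U\<close> by (intro card_mono) (auto simp: W_def)
      also have "\<dots> \<le> card (W - X) + card X" by (rule card_Un_le)
      finally show ?thesis .
    qed
    moreover have "real (card X) \<le> N / 4" using False s(1) by (simp add: N_def)
    ultimately have Z: "N / 2 \<le> card (W - X)" by linarith
    obtain Y where Y: "Y \<subseteq> X" and
      big: "real (card (W - X)) * (\<theta> / exp 1) powr y \<le> card {v\<in>W - X. nbrs E X v = Y}"
      using popular_trace[of X "W - X" \<theta> "nbrs E X"] \<open>finite X\<close> assms
      by (auto simp: W_def y_def nbrs_def)
    define M where "M = {v\<in>W - X. nbrs E X v = Y}"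
    have "finite M" using assms by (auto simp: M_def W_def)
    \<comment> \<open>The least integer strictly above \<open>y\<close>: the inserted set must be
      larger than the discarded trace \<open>Y\<close>, which has at most \<open>y\<close>
      elements.\<close>
    define r where "r = Suc (nat \<lfloor>y\<rfloor>)"
    have "y \<ge> 0" using assms by (simp add: y_def)
    then have r: "y < r" "r \<le> y + 1" by (auto simp: r_def) linarith
    have "4 * (2 * exp 1 / \<theta>) powr y \<le> N"
    proof -
      have "1 \<le> 2 * exp 1 / \<theta>" using assms one_le_exp_iff[of 1]
        by (simp add: le_divide_eq del: one_le_exp_iff) 
      then have "(2 * exp 1 / \<theta>) powr y \<le> (2 * exp 1 / \<theta>) powr (\<theta> * s)"
        using \<open>y \<le> \<theta> * s\<close> by (intro powr_mono) auto
      then show ?thesis using s(3) by (simp add: N_def)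
    qed
    \<comment> \<open>The factor 4 in the hypothesis pays for \<open>N / 2\<close> and for the extra
      1 in the exponent.\<close>
    then have "2 powr (y + 1) \<le> N / 2 * (\<theta> / exp 1) powr y"
      using assms by (simp add: powr_add powr_divide powr_mult field_simps)
    also have "\<dots> \<le> card (W - X) * (\<theta> / exp 1) powr y"
      using Z by (intro mult_right_mono) auto
    also have "\<dots> \<le> card M" using big by (simp add: M_def)
    finally have "2 powr (y + 1) \<le> card M" .
    moreover have "2 powr r \<le> 2 powr (y + 1)" using r by (intro powr_mono) auto
    ultimately have "2 powr real r \<le> real (card M)" by linarith
    then have "real (2 ^ r) \<le> real (card M)" by (simp add: powr_realpow)
    then have "2 ^ r \<le> card M" by (simp only: of_nat_le_iff)
    then obtain T where T: "T \<subseteq> M" "card T = r" "layered E T r"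
      using layered_of_card[OF assms(1) \<open>finite M\<close>] by blast
    have "real r \<le> real L" using r s(2) \<open>y \<le> \<theta> * s\<close> by linarith
    then have "layered E T L" using T layered_mono by auto
    \<comment> \<open>Vertices of \<open>T\<close> have no neighbours in \<open>X\<close> outside
      \<open>Y\<close>, so both height functions can be kept.\<close>
    have "layered E ((X - Y) \<union> T) L"
    proof (rule layered_Un)
      show "layered E (X - Y) L" using X layered_subset by blast
      fix x t assume "x \<in> X - Y" "t \<in> T"
      then show "(x, t) \<notin> E \<and> (t, x) \<notin> E"
        using T by (auto simp: M_def nbrs_def)
    qed fact
    moreover have "(X - Y) \<union> T \<subseteq> U" using X T by (auto simp: M_def W_def)
    ultimately have "card ((X - Y) \<union> T) \<le> card X" using max by (simp add: P_def)
    moreover have "card ((X - Y) \<union> T) = card (X - Y) + card T"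
      by (rule card_Un_disjoint) (use T \<open>finite X\<close> \<open>finite M\<close> finite_subset in \<open>auto simp: M_def\<close>)
    moreover have "card (X - Y) = card X - card Y" "card Y \<le> card X"
      using Y \<open>finite X\<close> by (auto simp: card_Diff_subset finite_subset card_mono)
    ultimately have "r \<le> card Y" using T by simp
    moreover have "real (card Y) \<le> y"
    proof -
      have "M \<noteq> {}" using \<open>2 ^ r \<le> card M\<close> by auto
      then obtain v where "v \<in> M" by blast
      then show ?thesis by (auto simp: M_def W_def)
    qed
    ultimately show ?thesis using r by linarith
  qed
qed

section \<open>Partitions into layered classes\<close>

text \<open>\<open>p\<close> gives the class and \<open>h\<close> the layer. Only arcs inside a
  class are constrained; classes and layers may be empty, so \<open>t\<close> and \<open>L\<close>
  are upper bounds.\<close>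

definition layer_partition :: "('a \<times> 'a) set \<Rightarrow> 'a set \<Rightarrow> nat \<Rightarrow> nat \<Rightarrow> bool" where
  "layer_partition E U t L \<longleftrightarrow>
     (\<exists>p h. (\<forall>x\<in>U. p x < t \<and> h x < L) \<and>
            (\<forall>x\<in>U. \<forall>y\<in>U. (x, y) \<in> E \<longrightarrow> p x = p y \<longrightarrow> h x < (h y :: nat)))"

lemma layer_partition_step:
  assumes "layered E X L" "layer_partition E (U - X) t L"
  shows "layer_partition E U (Suc t) L"
proof -
  obtain g where g: "\<forall>x\<in>X. g x < L" "\<forall>x\<in>X. \<forall>y\<in>X. (x, y) \<in> E \<longrightarrow> g x < g y"
    using assms(1) by (auto simp: layered_def)
  obtain p h where ph: "\<forall>x\<in>U - X. p x < t \<and> h x < L"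
    "\<forall>x\<in>U - X. \<forall>y\<in>U - X. (x, y) \<in> E \<longrightarrow> p x = p y \<longrightarrow> h x < h y"
    using assms(2) unfolding layer_partition_def by blast
  let ?p = "\<lambda>x. if x \<in> X then t else p x" and ?h = "\<lambda>x. if x \<in> X then g x else h x"
  have bound: "\<forall>x\<in>U. ?p x < Suc t \<and> ?h x < L"
    using g(1) ph(1) by (auto simp: less_Suc_eq)
  have mono: "?h x < ?h y" if "x \<in> U" "y \<in> U" "(x, y) \<in> E" "?p x = ?p y" for x y
  proof (cases "x \<in> X")
    case True
    have "y \<in> X"
    proof (rule ccontr)
      assume "y \<notin> X"
      then have "p y < t" using ph(1) that by blast
      then show False using True \<open>y \<notin> X\<close> that by simp
    qed
    then show ?thesis using True g(2) that by simp
  next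
    case False
    have "y \<notin> X"
    proof
      assume "y \<in> X"
      moreover have "p x < t" using ph(1) that False by blast
      ultimately show False using False that by simp
    qed
    then show ?thesis using False ph(2) that by simp
  qed
  show ?thesis
    unfolding layer_partition_def
    by (intro exI[of _ ?p] exI[of _ ?h] conjI bound ballI impI mono)
qed

lemma layer_partition_singletons:
  assumes "asym E" "finite U" "1 \<le> L"
  shows "layer_partition E U (card U) L"
  using assms(2)
proof (induction U rule: finite_induct)
  case empty
  then show ?case by (simp add: layer_partition_def)
next
  case (insert x U)
  have "(x, x) \<notin> E" using assms(1) by (blast dest: asymD)
  then have "layered E {x} L"
    using assms(3) unfolding layered_def by (intro exI[of _ "\<lambda>_. 0"]) auto
  moreover have "insert x U - {x} = U" using insert by blast
  ultimately show ?case
    using layer_partition_step[of E "{x}" L "insert x U" "card U"] insert by simp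
qed

text \<open>Greedy: sets of size \<open>r\<close> are split off as long as at least
  \<open>2 ^ r\<close> vertices remain, and the rest becomes singletons.\<close>

lemma layer_partition_of_card:
  assumes "asym E" "finite U" "1 \<le> r" "r \<le> L"
  shows "\<exists>t. layer_partition E U t L \<and> real t \<le> card U / r + 2 ^ r"
  using assms(2)
proof (induction "card U" arbitrary: U rule: less_induct)
  case less
  show ?case
  proof (cases "2 ^ r \<le> card U")
    case True
    obtain X where X: "X \<subseteq> U" "card X = r" "layered E X r"
      using layered_of_card[OF assms(1) less.prems True] by blast
    have "finite X" using X less.prems finite_subset by blast
    then have card: "card (U - X) = card U - r" "r \<le> card U"
      using X less.prems by (auto simp: card_Diff_subset card_mono)
    then have "card (U - X) < card U" using assms(3) by simp
    then obtain t where t: "layer_partition E (U - X) t L" "real t \<le> card (U - X) / r + 2 ^ r"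
      using less.hyps[of "U - X"] less.prems by auto
    have "layer_partition E U (Suc t) L"
      using layer_partition_step[OF layered_mono[OF X(3) assms(4)] t(1)] .
    moreover have "card (U - X) / r + 1 = real (card U) / r"
      using card assms(3) by (simp add: of_nat_diff field_simps)
    ultimately show ?thesis using t(2) by (intro exI[of _ "Suc t"]) auto
  next
    case False
    then have "real (card U) \<le> real (2 ^ r)" unfolding of_nat_le_iff by linarith
    then have "real (card U) \<le> 2 ^ r" unfolding of_nat_power by simp
    moreover have "0 \<le> real (card U) / r" by simp
    ultimately have "real (card U) \<le> card U / r + 2 ^ r" by linarith
    then show ?thesis
      using layer_partition_singletons[OF assms(1) less.prems, of L] assms by auto
  qed
qed

section \<open>Extracting layered sets from graphs with few arcs\<close>

lemma le_two_powr: "0 < u \<Longrightarrow> u \<le> 2 powr (u :: real)"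
proof -
  assume "0 < u"
  \<comment> \<open>Taken at \<open>u / 2\<close>, this gives
    \<open>ln u \<le> u / 2 - 1 + ln 2 \<le> u / 2 \<le> u * ln 2\<close>.\<close>
  then have "ln (u / 2) \<le> u / 2 - 1" by (intro ln_le_minus_one) simp
  moreover have "ln (u / 2) = ln u - ln 2" using \<open>0 < u\<close> by (simp add: ln_div)
  moreover have "ln 2 \<le> (1::real)" using ln_le_minus_one[of 2] by simp
  moreover have "1 / 2 \<le> ln (2::real)"
    using ln_le_minus_one[of "1/2"] by (simp add: ln_div)
  then have "u * (1/2) \<le> u * ln 2"
    using \<open>0 < u\<close> by (intro mult_left_mono) auto
  ultimately have "ln u \<le> u * ln 2" using \<open>0 < u\<close> by argo
  then have "exp (ln u) \<le> exp (u * ln 2)" by simp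
  then show ?thesis using \<open>0 < u\<close> by (simp add: powr_def)
qed

text \<open>With \<open>u\<close> the square root in the conclusion, the arc density is of order
  \<open>u ^ (-4)\<close>, which dictates \<open>\<theta>\<close>. Taking \<open>s\<close> of order
  \<open>u ^ 3 * log 2 D\<close> makes \<open>\<theta> * s\<close> of order
  \<open>log 2 D / u\<close>, small enough to absorb the logarithm of
  \<open>1 / \<theta>\<close>.\<close>

lemma layered_of_few_arcs:
  fixes D \<sigma> :: real
  assumes "asym E" "finite E" "finite U" "0 < \<sigma>" "1 < D"
    and E: "card E \<le> \<sigma>\<^sup>2 / 32 * D\<^sup>2" and U: "\<sigma> * D \<le> card U" "card U \<le> \<sigma>\<^sup>2 / 16 * D\<^sup>2"
    and D: "8 * sqrt D \<le> \<sigma> * D" "log 2 D / 14 + 1 \<le> real L" "log 2 D \<le> 7 * sqrt (\<sigma> * D)"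
  shows "\<exists>X\<subseteq>U. layered E X L \<and> log 2 D / 14 * sqrt (card U / (\<sigma> * D)) ^ 3 \<le> real (card X)"
proof -
  define N where "N = real (card U)"
  define u where "u = sqrt (N / (\<sigma> * D))"
  \<comment> \<open>Twice the upper bound on the average degree, so at least half of
    \<open>U\<close> has degree at most \<open>b\<close>.\<close>
  define b where "b = \<sigma>\<^sup>2 * D\<^sup>2 / (8 * N)"
  define W where "W = {v\<in>U. real (card (nbrs E U v)) \<le> b}"
  define \<theta> where "\<theta> = 1 / u ^ 4"
  define s where "s = log 2 D / 14 * u ^ 3"
  have \<sigma>D: "0 < \<sigma> * D" using assms by simp
  then have N: "0 < N" "\<sigma> * D \<le> N" using U by (simp_all add: N_def)
  have u1: "1 \<le> u" using N \<sigma>D by (simp add: u_def)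
  have u2: "u\<^sup>2 = N / (\<sigma> * D)" using N \<sigma>D by (simp add: u_def)
  have u4: "u ^ 4 = N\<^sup>2 / (\<sigma>\<^sup>2 * D\<^sup>2)"
  proof -
    have "u ^ 4 = (u\<^sup>2)\<^sup>2" by simp
    then show ?thesis unfolding u2 by (simp add: power_divide power_mult_distrib)
  qed
  have lg: "0 < log 2 D" using assms by simp
  have "0 < \<theta>" "\<theta> \<le> 1" using u1 by (auto simp: \<theta>_def one_le_power)
  have b: "b = \<theta> * N / 8" using N assms(4,5) unfolding \<theta>_def u4 b_def by (simp add: field_simps power2_eq_square)
  have "0 < b" unfolding b using N \<open>0 < \<theta>\<close> by simp
  have "real (\<Sum>v\<in>U. card (nbrs E U v)) \<le> 2 * card E"
    using sum_card_nbrs_le[OF assms(3,2)] by (metis of_nat_le_iff of_nat_mult of_nat_numeral)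
  also have "\<dots> \<le> N / 2 * b"
    using E N by (simp add: b_def)
  finally have "N - N / 2 \<le> card W"
    using card_small_values_ge[OF assms(3), of "\<lambda>v. card (nbrs E U v)" "N / 2" b] N \<open>0 < b\<close>
    unfolding W_def N_def by simp
  then have W: "N / 2 \<le> card W" by simp
  have "finite W" using assms(3) by (simp add: W_def)
  have deg: "real (card (nbrs E W v)) \<le> \<theta> * card W / 4" if "v \<in> W" for v
  proof -
    have "card (nbrs E W v) \<le> card (nbrs E U v)"
      by (intro card_mono finite_nbrs assms(3)) (auto simp: nbrs_def W_def)
    then have "real (card (nbrs E W v)) \<le> b" using that by (simp add: W_def)
    also have "\<dots> \<le> \<theta> * card W / 4"
      using W \<open>0 < \<theta>\<close> by (simp add: b)
    finally show ?thesis .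
  qed
  \<comment> \<open>The upper bound on \<open>card U\<close> is what keeps \<open>u\<close>, and
    with it \<open>s\<close>, from outgrowing \<open>N\<close>.\<close>
  have "s \<le> N / 8"
  proof -
    have "u\<^sup>2 \<le> (sqrt (\<sigma> * D) / 4)\<^sup>2"
    proof -
      have "N \<le> (\<sigma> * D / 16) * (\<sigma> * D)"
        using U(2) by (simp add: N_def power2_eq_square mult_ac)
      then show ?thesis using \<sigma>D by (simp add: u2 power_divide pos_divide_le_eq)
    qed
    then have "u \<le> sqrt (\<sigma> * D) / 4" by (rule power2_le_imp_le) (use \<sigma>D in simp)
    then have "log 2 D * u \<le> 7 * sqrt (\<sigma> * D) * (sqrt (\<sigma> * D) / 4)"
      using D(3) u1 \<sigma>D by (intro mult_mono) auto
    also have "\<dots> = 7 / 4 * (\<sigma> * D)" using \<sigma>D by simp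
    finally have "log 2 D * u / 14 \<le> \<sigma> * D / 8" by linarith
    then have "log 2 D * u / 14 * u\<^sup>2 \<le> (\<sigma> * D / 8) * u\<^sup>2"
      by (intro mult_right_mono) auto
    moreover have "s = log 2 D * u / 14 * u\<^sup>2" by (simp add: s_def power2_eq_square power3_eq_cube)
    moreover have "(\<sigma> * D / 8) * u\<^sup>2 = N / 8" using assms(4,5) by (simp add: u2)
    ultimately show ?thesis by (simp only:)
  qed
  have \<theta>s: "\<theta> * s = log 2 D / (14 * u)"
    using u1 by (simp add: \<theta>_def s_def field_simps eval_nat_numeral)
  \<comment> \<open>The base is at most \<open>2 powr (3 + 4 * u)\<close>, hence at most
    \<open>2 powr (7 * u)\<close>. As \<open>\<theta> * s = log 2 D / (14 * u)\<close> and
    \<open>14 = 2 * 7\<close>, the power is at most \<open>sqrt D\<close>.\<close>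
  have "(2 * exp 1 / \<theta>) powr (\<theta> * s) \<le> (2 powr (7 * u)) powr (\<theta> * s)"
  proof (rule powr_mono2)
    have "2 * exp 1 / \<theta> = 2 * exp 1 * u ^ 4" by (simp add: \<theta>_def)
    also have "\<dots> \<le> 8 * (2 powr u) ^ 4"
    proof (intro mult_mono power_mono le_two_powr)
      show "2 * exp 1 \<le> (8::real)" using exp_le by simp
    qed (use u1 in auto)
    also have "\<dots> = 2 powr (3 + 4 * u)"
      by (simp add: powr_add powr_power mult.commute)
    also have "\<dots> \<le> 2 powr (7 * u)" using u1 by (intro powr_mono) auto
    finally show "2 * exp 1 / \<theta> \<le> 2 powr (7 * u)" .
  qed (use \<open>0 < \<theta>\<close> u1 lg in \<open>auto simp: s_def\<close>)
  also have "\<dots> = 2 powr (log 2 D * (1 / 2))"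
    using u1 by (simp add: powr_powr \<theta>s)
  also have "\<dots> = sqrt D"
    using assms(5) by (simp only: powr_powr[symmetric]) (simp add: powr_half_sqrt)
  finally have "4 * (2 * exp 1 / \<theta>) powr (\<theta> * s) \<le> card W"
    using D(1) N W by linarith
  moreover have "\<theta> * s + 1 \<le> real L"
  proof -
    have "log 2 D / (14 * u) \<le> log 2 D / 14"
      using lg u1 by (simp add: field_simps)
    then show ?thesis using D(2) \<theta>s by linarith
  qed
  moreover have "0 < s" using lg u1 by (simp add: s_def)
  moreover have "s \<le> card W / 4" using \<open>s \<le> N / 8\<close> W by linarith
  ultimately obtain X where "X \<subseteq> W" "layered E X L" "s \<le> real (card X)"
    using layered_of_sparse[OF assms(1) \<open>finite W\<close> \<open>0 < \<theta>\<close> \<open>\<theta> \<le> 1\<close> _ deg, of s L] by blast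
  then show ?thesis by (auto simp: s_def u_def N_def W_def)
qed

text \<open>Follows from \<open>(1 - a) * (1 + a / 2)\<^sup>2 \<le> 1\<close>: losing a fraction
  \<open>a\<close> of \<open>u\<^sup>2\<close> raises \<open>1 / u\<close> by a factor of at least
  \<open>1 + a / 2\<close>.\<close>

lemma inverse_gap:
  fixes u u' a :: real
  assumes "0 < u" "0 < u'" "0 \<le> a" "u'\<^sup>2 \<le> u\<^sup>2 * (1 - a)"
  shows "(1 + a / 2) / u \<le> 1 / u'"
proof -
  have "(u' * (1 + a / 2))\<^sup>2 \<le> u\<^sup>2 * ((1 - a) * (1 + a / 2)\<^sup>2)"
    using mult_right_mono[OF assms(4), of "(1 + a / 2)\<^sup>2"] by (simp add: power_mult_distrib)
  also have "(1 - a) * (1 + a / 2)\<^sup>2 = 1 - 3 / 4 * a\<^sup>2 - a ^ 3 / 4"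
    by (simp add: power2_eq_square power3_eq_cube field_simps)
  also have "u\<^sup>2 * \<dots> \<le> u\<^sup>2 * 1"
  proof (rule mult_left_mono)
    have "0 \<le> 3 / 4 * a\<^sup>2" "0 \<le> a ^ 3 / 4" using assms by simp_all
    then show "1 - 3 / 4 * a\<^sup>2 - a ^ 3 / 4 \<le> 1" by linarith
  qed simp
  finally have "(u' * (1 + a / 2))\<^sup>2 \<le> u\<^sup>2" by simp
  then have "u' * (1 + a / 2) \<le> u"
    by (rule power2_le_imp_le) (use assms(1) in simp)
  then have "(1 + a / 2) * u' \<le> 1 * u" by (simp add: mult.commute)
  then show ?thesis using assms(1,2) by (simp only: frac_le_eq pos_divide_le_eq pos_le_divide_eq times_divide_eq_left)
qed

text \<open>With \<open>u = sqrt (|U| / (\<sigma> D))\<close>, one extraction step removes at least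
  \<open>log D / 14 * u\<^sup>3\<close> vertices and thus increases \<open>1 / u\<close> by at least \<open>log D / (28 \<sigma> D)\<close>.\<close>
lemma layer_partition_of_few_arcs:
  fixes D \<sigma> :: real
  assumes "asym E" "finite E" "finite U" "0 < \<sigma>" "1 < D" "1 \<le> r" "r \<le> L"
    and E: "card E \<le> \<sigma>\<^sup>2 / 32 * D\<^sup>2" and U: "card U \<le> \<sigma>\<^sup>2 / 16 * D\<^sup>2"
    and D: "8 * sqrt D \<le> \<sigma> * D" "log 2 D / 14 + 1 \<le> real L" "log 2 D \<le> 7 * sqrt (\<sigma> * D)"
  shows "\<exists>t. layer_partition E U t L \<and>
    real t \<le> \<sigma> * D / r + 2 ^ r + (if card U < \<sigma> * D then 0
      else 1 + 28 * \<sigma> * D / log 2 D * (1 - 1 / sqrt (card U / (\<sigma> * D))))"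
  using assms(3) U
proof (induction "card U" arbitrary: U rule: less_induct)
  case less
  have \<sigma>D: "0 < \<sigma> * D" using assms by simp
  have lg: "0 < log 2 D" using assms by simp
  show ?case
  proof (cases "card U < \<sigma> * D")
    case True
    obtain t where t: "layer_partition E U t L" "real t \<le> card U / r + 2 ^ r"
      using layer_partition_of_card[OF assms(1) less.prems(1) assms(6,7)] by blast
    have "card U / r \<le> \<sigma> * D / r" using True assms(6) by (intro divide_right_mono) auto
    then show ?thesis using t True by (intro exI[of _ t]) auto
  next
    case False
    define u where "u = sqrt (card U / (\<sigma> * D))"
    define C where "C = 28 * \<sigma> * D / log 2 D"
    have "0 < C" using assms(4,5) lg unfolding C_def by (intro divide_pos_pos mult_pos_pos) auto
    have u1: "1 \<le> u" using False \<sigma>D by (simp add: u_def)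
    obtain X where X: "X \<subseteq> U" "layered E X L" "log 2 D / 14 * u ^ 3 \<le> real (card X)"
      using layered_of_few_arcs[OF assms(1,2) less.prems(1) assms(4,5) E _ less.prems(2) D] False
      unfolding u_def by auto
    have "finite X" using X less.prems finite_subset by blast
    then have card: "card (U - X) = card U - card X" "card X \<le> card U"
      using X less.prems by (auto simp: card_Diff_subset card_mono)
    have "0 < log 2 D / 14 * u ^ 3" using lg u1 by simp
    then have "0 < card X" using X(3) by linarith
    then have lt: "card (U - X) < card U" using card by simp
    define u' where "u' = sqrt (card (U - X) / (\<sigma> * D))"
    have "real (card (U - X)) \<le> \<sigma>\<^sup>2 / 16 * D\<^sup>2" using lt less.prems(2) by linarith
    then obtain t where t: "layer_partition E (U - X) t L"
      "real t \<le> \<sigma> * D / r + 2 ^ r + (if card (U - X) < \<sigma> * D then 0 else 1 + C * (1 - 1 / u'))"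
      using less.hyps[OF lt] less.prems(1) unfolding C_def u'_def by blast
    \<comment> \<open>The new class must be paid for by the drop of the bound. If the threshold
      \<open>\<sigma> * D\<close> is crossed, the additive 1 pays; otherwise the growth of
      \<open>1 / u\<close> does.\<close>
    have "(if card (U - X) < \<sigma> * D then 0 else 1 + C * (1 - 1 / u')) + 1 \<le> 1 + C * (1 - 1 / u)"
    proof (cases "card (U - X) < \<sigma> * D")
      case True
      have "0 \<le> C * (1 - 1 / u)" using \<open>0 < C\<close> u1 by simp
      then show ?thesis using True by simp
    next
      case False
      \<comment> \<open>The guaranteed fraction of \<open>U\<close> that \<open>X\<close>
        removes.\<close>
      define a where "a = log 2 D * u / (14 * (\<sigma> * D))"
      have "1 \<le> u'" using False \<sigma>D by (simp add: u'_def)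
      have "u'\<^sup>2 = card (U - X) / (\<sigma> * D)" using \<sigma>D by (simp add: u'_def)
      also have "\<dots> = u\<^sup>2 - card X / (\<sigma> * D)"
        using card \<sigma>D by (simp add: u_def of_nat_diff diff_divide_distrib)
      also have "\<dots> \<le> u\<^sup>2 - log 2 D / 14 * u ^ 3 / (\<sigma> * D)"
        using X(3) \<sigma>D by (intro diff_left_mono divide_right_mono) auto
      also have "\<dots> = u\<^sup>2 * (1 - a)"
        by (simp add: a_def right_diff_distrib power2_eq_square power3_eq_cube)
      finally have "(1 + a / 2) / u \<le> 1 / u'"
        using u1 \<open>1 \<le> u'\<close> lg \<sigma>D by (intro inverse_gap) (auto simp: a_def)
      then have "C * ((1 + a / 2) / u) \<le> C * (1 / u')"
        using \<open>0 < C\<close> by (intro mult_left_mono) auto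
      moreover have "C * a = 2 * u"
      proof -
        have "log 2 D \<noteq> 0" using lg by linarith
        with assms(4,5) show ?thesis by (simp add: C_def a_def)
      qed
      then have "C * ((1 + a / 2) / u) = C / u + 1"
        using u1 by (simp add: add_divide_distrib distrib_left)
      ultimately show ?thesis using False by (simp add: right_diff_distrib)
    qed
    then have "real (Suc t) \<le> \<sigma> * D / r + 2 ^ r + (1 + C * (1 - 1 / u))"
      using t(2) by simp
    then show ?thesis
      using layer_partition_step[OF X(2) t(1)] False unfolding C_def u_def
      by (intro exI[of _ "Suc t"]) simp
  qed
qed

section \<open>From layer partitions to colourings\<close>

text \<open>Digit \<open>i\<close> of \<open>x\<close> in base \<open>b\<close>, so that numbers
  below \<open>b ^ m\<close> serve as points of a grid with \<open>m\<close> coordinates.\<close>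

definition digit :: "nat \<Rightarrow> nat \<Rightarrow> nat \<Rightarrow> nat" where
  "digit b i x = (x div b ^ i) mod b"

lemma digit_less: "0 < b \<Longrightarrow> digit b i x < b"
  by (simp add: digit_def)

text \<open>If the quotients by \<open>b\<close> agree, the lowest digit decides; otherwise the
  quotients are ordered like \<open>x\<close> and \<open>y\<close> and have one digit fewer.\<close>

lemma digit_less_of_less:
  "x < y \<Longrightarrow> y < b ^ m \<Longrightarrow> \<exists>i<m. digit b i x < digit b i y"
proof (induction m arbitrary: x y)
  case (Suc m)
  show ?case
  proof (cases "x div b = y div b")
    case True
    have "x mod b < y mod b"
      using Suc.prems(1) True by (metis add_less_cancel_left div_mult_mod_eq)
    then show ?thesis by (intro exI[of _ 0]) (simp add: digit_def)
  next
    case False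
    have "x div b < y div b"
      using False Suc.prems(1) div_le_mono[of x y b] by simp
    moreover have "y div b < b ^ m"
      using Suc.prems(2) by (simp add: less_mult_imp_div_less mult.commute)
    ultimately obtain i where "i < m" "digit b i (x div b) < digit b i (y div b)"
      using Suc.IH by blast
    then show ?thesis
      by (intro exI[of _ "Suc i"]) (simp add: digit_def div_mult2_eq)
  qed
qed simp

lemma digit_neq_of_neq:
  assumes "x \<noteq> y" "x < b ^ m" "y < b ^ m"
  shows "\<exists>i<m. digit b i x \<noteq> digit b i y"
  using assms digit_less_of_less[of x y b m] digit_less_of_less[of y x b m]
  by (metis linorder_neqE_nat less_irrefl)

text \<open>A class is a point of the grid \<open>[r]\<^sup>k\<close> and a layer a point of \<open>[l]\<^bsup>k+1\<^esup>\<close>. The first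
  \<open>k\<close> potentials order the vertices lexicographically by the corresponding coordinates; the last
  one takes the arcs between classes along which every coordinate weakly decreases.\<close>
lemma increasing_potentials:
  assumes "layer_partition E U t L" "t \<le> r ^ k" "L \<le> l ^ (k + 1)" "1 \<le> k"
  shows "\<exists>\<phi> :: nat \<Rightarrow> 'a \<Rightarrow> nat. (\<forall>j\<le>k. \<forall>x\<in>U. \<phi> j x < k * r * l) \<and>
    (\<forall>x\<in>U. \<forall>y\<in>U. (x, y) \<in> E \<longrightarrow> (\<exists>j\<le>k. \<phi> j x < \<phi> j y))"
proof -
  obtain p h where ph': "\<forall>x\<in>U. p x < t \<and> h x < L"
    "\<forall>x\<in>U. \<forall>y\<in>U. (x, y) \<in> E \<longrightarrow> p x = p y \<longrightarrow> h x < (h y :: nat)"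
    using assms(1) unfolding layer_partition_def by blast
  have p: "p x < r ^ k" and h: "h x < l ^ (k + 1)" if "x \<in> U" for x
    using ph'(1) assms(2,3) that by (meson order_less_le_trans)+
  have ph: "h x < h y" if "x \<in> U" "y \<in> U" "(x, y) \<in> E" "p x = p y" for x y
    using ph'(2) that by blast
  have pos: "0 < r" "0 < l" if "x \<in> U" for x
    using p[OF that] h[OF that] assms(4) by (auto intro!: Nat.gr0I simp: power_0_left)
  \<comment> \<open>The complemented digit sum rises when no class coordinate increases and some
    coordinate decreases.\<close>
  define S where "S = (\<lambda>x. \<Sum>i<k. r - 1 - digit r i (p x))"
  \<comment> \<open>A lexicographic pair coded as one number: class part first, with a layer digit
    below \<open>l\<close> as tie-breaker.\<close>
  define \<phi> where "\<phi> = (\<lambda>j x. (if j < k then digit r j (p x) else S x) * l + digit l j (h x))"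
  have \<phi>_less: "\<phi> j x < \<phi> j y"
    if "x \<in> U" "(if j < k then digit r j (p x) else S x) < (if j < k then digit r j (p y) else S y)"
    for j x y
  proof -
    have "\<phi> j x < (if j < k then digit r j (p x) else S x) * l + l"
      using digit_less[OF pos(2)[OF that(1)]] by (simp add: \<phi>_def)
    also have "\<dots> = Suc (if j < k then digit r j (p x) else S x) * l" by simp
    also have "\<dots> \<le> (if j < k then digit r j (p y) else S y) * l"
      using that(2) by (intro mult_right_mono) auto
    also have "\<dots> \<le> \<phi> j y" by (simp add: \<phi>_def)
    finally show ?thesis .
  qed
  have "\<phi> j x < k * r * l" if "x \<in> U" for j x
  proof -
    have "(if j < k then digit r j (p x) else S x) < k * r"
    proof (cases "j < k")
      case True
      have "digit r j (p x) < r" using digit_less pos that by blast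
      also have "r \<le> k * r" using assms(4) by simp
      finally show ?thesis using True by simp
    next
      case False
      have "S x \<le> (\<Sum>i<k. r - 1)" unfolding S_def by (intro sum_mono) simp
      also have "\<dots> = k * (r - 1)" by simp
      also have "\<dots> < k * r" using pos(1)[OF that] assms(4) by simp
      finally show ?thesis using False by simp
    qed
    then have "Suc (if j < k then digit r j (p x) else S x) * l \<le> k * r * l"
      by (intro mult_right_mono) auto
    then show ?thesis
      using digit_less[OF pos(2)[OF that], of j "h x"] by (simp add: \<phi>_def)
  qed
  moreover have "\<exists>j\<le>k. \<phi> j x < \<phi> j y" if xy: "x \<in> U" "y \<in> U" "(x, y) \<in> E" for x y
  proof (cases "p x = p y")
    case True
    then have "h x < h y" using ph xy by blast
    \<comment> \<open>Inside a class all class parts tie, so the layer digit \<open>i\<close>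
      decides for colour \<open>i\<close>; the value \<open>i = k\<close> is possible.\<close>
    then obtain i where "i < k + 1" "digit l i (h x) < digit l i (h y)"
      using digit_less_of_less[OF _ h[OF xy(2)]] by blast
    then show ?thesis using True by (intro exI[of _ i]) (simp add: \<phi>_def S_def)
  next
    case False
    then obtain i where i: "i < k" "digit r i (p x) \<noteq> digit r i (p y)"
      using digit_neq_of_neq[OF _ p[OF xy(1)] p[OF xy(2)]] by blast
    show ?thesis
    proof (cases "\<exists>j<k. digit r j (p x) < digit r j (p y)")
      case True
      then show ?thesis using \<phi>_less[OF xy(1)] by (metis less_imp_le)
    next
      case False
      then have le: "digit r j (p y) \<le> digit r j (p x)" if "j < k" for j
        using that by (meson not_le)
      have "S x < S y"
        unfolding S_def
      proof (rule sum_strict_mono_ex1)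
        show "\<exists>j\<in>{..<k}. r - 1 - digit r j (p x) < r - 1 - digit r j (p y)"
        proof
          show "r - 1 - digit r i (p x) < r - 1 - digit r i (p y)"
            using i le[OF i(1)] digit_less[OF pos(1)[OF xy(1)], of i "p x"] by linarith
        qed (use i in simp)
      qed (use le in \<open>auto intro: diff_le_mono2\<close>)
      then show ?thesis using \<phi>_less[OF xy(1), of k y] by auto
    qed
  qed
  ultimately show ?thesis by blast
qed

text \<open>Each arc gets the least colour whose potential rises along it. On a monochromatic path
  with \<open>n\<close> vertices that potential would reach at least \<open>n - 1\<close> at the
  last vertex.\<close>

lemma not_arrows_of_potentials:
  assumes "\<And>j x. j \<le> k \<Longrightarrow> x \<in> Field (parcs G) \<Longrightarrow> \<phi> j x < (n - 1 :: nat)"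
    and "\<And>x y. (x, y) \<in> parcs G \<Longrightarrow> \<exists>j\<le>k. \<phi> j x < \<phi> j y" and "2 \<le> n"
  shows "\<not> arrows G (directed_path n) (k + 1)"
proof
  assume arrows: "arrows G (directed_path n) (k + 1)"
  define c where "c = (\<lambda>e. LEAST j. \<phi> j (fst e) < \<phi> j (snd e))"
  have c: "c (x, y) < k + 1 \<and> \<phi> (c (x, y)) x < \<phi> (c (x, y)) y" if "(x, y) \<in> parcs G" for x y
  proof -
    obtain j where j: "j \<le> k" "\<phi> j x < \<phi> j y" using assms(2) \<open>(x, y) \<in> parcs G\<close> by blast
    have "c (x, y) \<le> j" unfolding c_def using j by (intro Least_le) simp
    moreover have "\<phi> (c (x, y)) x < \<phi> (c (x, y)) y"
      unfolding c_def using LeastI[of "\<lambda>j. \<phi> j x < \<phi> j y", OF j(2)] by simp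
    ultimately show ?thesis using j by simp
  qed
  have "\<forall>e\<in>parcs G. c e < k + 1"
    using c by (metis prod.collapse)
  then obtain j where "j < k + 1" "contains_copy (colour_class G c j) (directed_path n)"
    using arrows unfolding arrows_def by blast
  then obtain f where
    "\<forall>u v. (u, v) \<in> parcs (directed_path n) \<longrightarrow> (f u, f v) \<in> parcs (colour_class G c j)"
    unfolding contains_copy_def by blast
  then have f: "(f i, f (i + 1)) \<in> parcs G \<and> c (f i, f (i + 1)) = j" if "1 \<le> i" "i < n" for i
    using that by (simp add: colour_class_def directed_path_def)
  have "i \<le> \<phi> j (f (i + 1))" if "i < n" for i
    using that
  proof (induction i)
    case (Suc i)
    then have "\<phi> j (f (i + 1)) < \<phi> j (f (i + 1 + 1))"
      using f[of "i + 1"] c[of "f (i + 1)" "f (i + 1 + 1)"] by simp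
    then show ?case using Suc by simp
  qed simp
  from this[of "n - 1"] have "n - 1 \<le> \<phi> j (f n)" using assms(3) by simp
  moreover have "(f (n - 1), f n) \<in> parcs G" using f[of "n - 1"] assms(3) by simp
  then have "f n \<in> Field (parcs G)" by (rule FieldI2)
  then have "\<phi> j (f n) < n - 1" using assms(1) \<open>j < k + 1\<close> by simp
  ultimately show False by simp
qed

lemma not_arrows_of_layer_partition:
  assumes "layer_partition (parcs G) (Field (parcs G)) t L" "t \<le> r ^ k" "L \<le> l ^ (k + 1)"
    "1 \<le> k" "2 \<le> n" "k * r * l \<le> n - 1"
  shows "\<not> arrows G (directed_path n) (k + 1)"
proof -
  obtain \<phi> :: "nat \<Rightarrow> 'a \<Rightarrow> nat"
    where "\<forall>j\<le>k. \<forall>x\<in>Field (parcs G). \<phi> j x < k * r * l"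
      "\<forall>x\<in>Field (parcs G). \<forall>y\<in>Field (parcs G). (x, y) \<in> parcs G \<longrightarrow> (\<exists>j\<le>k. \<phi> j x < \<phi> j y)"
    using increasing_potentials[OF assms(1-4)] by blast
  then show ?thesis
    using assms(5,6)
    by (intro not_arrows_of_potentials[of k G \<phi>]) (blast intro: FieldI1 FieldI2 order_less_le_trans)+
qed

section \<open>Arrowing graphs\<close>

definition transitive_tournament :: "nat \<Rightarrow> nat pair_pre_digraph" where
  "transitive_tournament N = \<lparr> pverts = {..<N}, parcs = {(i, j). i < j \<and> j < N} \<rparr>"

lemma oriented_transitive_tournament: "oriented_graph (transitive_tournament N)"
proof -
  have "{(i, j). i < j \<and> j < N} \<subseteq> {..<N} \<times> {..<N}" by auto
  then have "finite {(i, j). i < j \<and> j < N}" by (rule finite_subset) simp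
  then have "pair_digraph (transitive_tournament N)"
    unfolding transitive_tournament_def by unfold_locales auto
  then show ?thesis
    by (auto simp: oriented_graph_def transitive_tournament_def)
qed

text \<open>Ramsey's theorem for pairs, each coloured by its ascending arc: a monochromatic set of
  \<open>n\<close> numbers, listed in increasing order, is a monochromatic directed path.\<close>

lemma arrows_transitive_tournament:
  "\<exists>N. arrows (transitive_tournament N) (directed_path n) q"
proof -
  obtain N :: nat where N: "partn_lst {..<N} (replicate q n) 2"
    using ramsey_full[of "replicate q n" 2] by blast
  have "\<exists>j<q. contains_copy (colour_class (transitive_tournament N) c j) (directed_path n)"
    if c: "\<forall>e\<in>parcs (transitive_tournament N). c e < q" for c
  proof -
    define g where "g = (\<lambda>A. c (Min A, Max A))"
    have "g \<in> [{..<N}]\<^bsup>2\<^esup> \<rightarrow> {..<q}"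
    proof
      fix A assume "A \<in> [{..<N}]\<^bsup>2\<^esup>"
      then obtain x y where "A = {x, y}" "x < y" "y < N"
        by (force simp: ordered_nsets_2_eq)
      then show "g A \<in> {..<q}"
        using c by (auto simp: g_def transitive_tournament_def min_def max_def)
    qed
    then obtain j H where j: "j < q" and H: "H \<in> [{..<N}]\<^bsup>n\<^esup>" and gH: "g ` [H]\<^bsup>2\<^esup> \<subseteq> {j}"
      using N by (auto simp: partn_lst_def monochromatic_def)
    have "finite H" "card H = n" "H \<subseteq> {..<N}" using H by (auto simp: nsets_def)
    define f where "f = (\<lambda>i. sorted_list_of_set H ! (i - 1))"
    have len: "length (sorted_list_of_set H) = n" using \<open>card H = n\<close> by simp
    have fH: "f i \<in> H" if "1 \<le> i" "i \<le> n" for i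
      using that len \<open>finite H\<close> nth_mem[of "i - 1" "sorted_list_of_set H"] by (simp add: f_def)
    have f_less: "f i < f i'" if "1 \<le> i" "i < i'" "i' \<le> n" for i i'
      unfolding f_def
      by (rule sorted_wrt_nth_less[OF strict_sorted_list_of_set]) (use that len in auto)
    have "inj_on f {1..n}"
      by (rule linorder_inj_onI) (use f_less in fastforce)+
    moreover have "f ` {1..n} \<subseteq> {..<N}"
    proof
      fix y assume "y \<in> f ` {1..n}"
      then obtain i where "1 \<le> i" "i \<le> n" "y = f i" by auto
      then show "y \<in> {..<N}" using fH \<open>H \<subseteq> {..<N}\<close> by blast
    qed
    moreover have "f i < f (i + 1) \<and> f (i + 1) < N \<and> c (f i, f (i + 1)) = j" if "1 \<le> i" "i < n" for i
    proof -
      have "f i < f (i + 1)" using f_less that by simp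
      moreover have "f i \<in> H" "f (i + 1) \<in> H" using fH that by auto
      ultimately have "{f i, f (i + 1)} \<in> [H]\<^bsup>2\<^esup>" by simp
      then have "g {f i, f (i + 1)} = j" using gH by blast
      then show ?thesis
        using \<open>f i < f (i + 1)\<close> \<open>f (i + 1) \<in> H\<close> \<open>H \<subseteq> {..<N}\<close>
        by (auto simp: g_def min_def max_def)
    qed
    ultimately have "contains_copy (colour_class (transitive_tournament N) c j) (directed_path n)"
      unfolding contains_copy_def
      by (intro exI[of _ f]) (auto simp: colour_class_def transitive_tournament_def directed_path_def)
    then show ?thesis using j by blast
  qed
  then show ?thesis unfolding arrows_def by blast
qed

text \<open>The \<open>LEAST\<close> carries information only once some graph is known to arrow the
  path; transitive tournaments supply it.\<close>

lemma oriented_size_ramsey_attained: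
  obtains G :: "nat pair_pre_digraph" where
    "oriented_graph G" "card (parcs G) = oriented_size_ramsey (directed_path n) q"
    "arrows G (directed_path n) q"
proof -
  obtain N where "arrows (transitive_tournament N) (directed_path n) q"
    using arrows_transitive_tournament by blast
  then have "\<exists>m. \<exists>G :: nat pair_pre_digraph.
      oriented_graph G \<and> card (parcs G) = m \<and> arrows G (directed_path n) q"
    using oriented_transitive_tournament by blast
  from LeastI_ex[OF this] show thesis
    using that unfolding oriented_size_ramsey_def by blast
qed

lemma finite_parcs: "oriented_graph G \<Longrightarrow> finite (parcs G)"
  by (simp add: oriented_graph_def pair_digraph_def pair_fin_digraph.pair_finite_arcs)

lemma asym_parcs: "oriented_graph G \<Longrightarrow> asym (parcs G)"
  by (auto simp: oriented_graph_def intro!: asymI)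

text \<open>A constant colouring suffices. This trivial bound covers the finitely many
  \<open>n\<close> below the asymptotic threshold.\<close>

lemma arrows_imp_arcs:
  assumes "oriented_graph G" "arrows G (directed_path n) (Suc q)" "2 \<le> n"
  shows "1 \<le> card (parcs G)"
proof -
  obtain j where "contains_copy (colour_class G (\<lambda>_. 0) j) (directed_path n)"
    using assms(2) unfolding arrows_def by (metis zero_less_Suc)
  then have "parcs G \<noteq> {}"
    using assms(3) by (auto simp: contains_copy_def colour_class_def directed_path_def)
  then show ?thesis using finite_parcs[OF assms(1)] by (simp add: Suc_leI card_gt_0_iff)
qed

lemma card_Field_le: "finite E \<Longrightarrow> card (Field E) \<le> 2 * card E"
  unfolding Field_def Domain_fst Range_snd
  using card_Un_le[of "fst ` E" "snd ` E"] card_image_le[of E fst] card_image_le[of E snd]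
  by linarith

section \<open>Choice of parameters and asymptotics\<close>

lemma eventually_layer_partition:
  fixes \<sigma> :: real
  assumes "0 < \<sigma>"
  shows "\<exists>D0>1. \<forall>D\<ge>D0. \<forall>E :: ('a \<times> 'a) set. finite E \<longrightarrow> asym E \<longrightarrow> card E \<le> \<sigma>\<^sup>2 / 32 * D\<^sup>2 \<longrightarrow>
    (\<exists>t L. layer_partition E (Field E) t L \<and> real L \<le> log 2 D \<and> real t \<le> 33 * \<sigma> * D / log 2 D)"
proof -
  have "eventually (\<lambda>D. 8 * sqrt D \<le> \<sigma> * D) at_top"
    "eventually (\<lambda>D. log 2 D / 14 + 2 \<le> log 2 D) at_top"
    "eventually (\<lambda>D. log 2 D \<le> 7 * sqrt (\<sigma> * D)) at_top"
    "eventually (\<lambda>D. log 2 D / 4 + 2 \<le> log 2 D) at_top"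
    "eventually (\<lambda>D. 2 * D powr (1/4) + 1 \<le> \<sigma> * D / log 2 D) at_top"
    "eventually (\<lambda>D :: real. 1 < D) at_top"
    using assms by real_asymp+
  then have "eventually (\<lambda>D. 8 * sqrt D \<le> \<sigma> * D \<and> log 2 D / 14 + 2 \<le> log 2 D \<and>
     log 2 D \<le> 7 * sqrt (\<sigma> * D) \<and> log 2 D / 4 + 2 \<le> log 2 D \<and>
     2 * D powr (1/4) + 1 \<le> \<sigma> * D / log 2 D \<and> 1 < D) at_top"
    by eventually_elim auto
  then obtain D1 where D1: "D1 \<le> D \<Longrightarrow> 8 * sqrt D \<le> \<sigma> * D \<and> log 2 D / 14 + 2 \<le> log 2 D \<and>
     log 2 D \<le> 7 * sqrt (\<sigma> * D) \<and> log 2 D / 4 + 2 \<le> log 2 D \<and>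
     2 * D powr (1/4) + 1 \<le> \<sigma> * D / log 2 D \<and> 1 < D" for D
    unfolding eventually_at_top_linorder by blast
  show ?thesis
  proof (intro exI[of _ "max D1 2"] conjI allI impI)
    fix D and E :: "('a \<times> 'a) set"
    assume "max D1 2 \<le> D" and E: "finite E" "asym E" "card E \<le> \<sigma>\<^sup>2 / 32 * D\<^sup>2"
    then have D: "8 * sqrt D \<le> \<sigma> * D" "log 2 D / 14 + 2 \<le> log 2 D"
     "log 2 D \<le> 7 * sqrt (\<sigma> * D)" "log 2 D / 4 + 2 \<le> log 2 D"
     "2 * D powr (1/4) + 1 \<le> \<sigma> * D / log 2 D" "1 < D"
      using D1[of D] by auto
    define lg where "lg = log 2 D"
    have lg: "0 < lg" using D by (simp add: lg_def)
    define L where "L = nat \<lfloor>lg\<rfloor>"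
    \<comment> \<open>A quarter of the logarithm keeps \<open>2 ^ r\<close> at most
      \<open>2 * D powr (1/4)\<close>, of lower order than \<open>D / log 2 D\<close>.\<close>
    define r where "r = nat \<lceil>lg / 4\<rceil>"
    have L: "real L \<le> lg" "lg \<le> real L + 1" using lg by (auto simp: L_def)
    have r: "lg / 4 \<le> real r" "real r \<le> lg / 4 + 1" using lg by (auto simp: r_def)
    have "1 \<le> r" using r(1) lg by (cases r) auto
    have "real r < real L + 1" using r(2) L(2) D(4) by (simp add: lg_def)
    then have "r \<le> L" by linarith
    have "finite (Field E)" using E(1) by (simp add: finite_Field)
    \<comment> \<open>Isolated vertices are left out, so there are at most twice as many vertices as
      arcs; hence 16 against 32.\<close>
    moreover have "real (card (Field E)) \<le> \<sigma>\<^sup>2 / 16 * D\<^sup>2"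
      using card_Field_le[OF E(1)] E(3) by linarith
    moreover have "log 2 D / 14 + 1 \<le> real L" using D(2) L(2) by (simp add: lg_def)
    ultimately obtain t where t: "layer_partition E (Field E) t L" and
      t': "real t \<le> \<sigma> * D / r + 2 ^ r + (if card (Field E) < \<sigma> * D then 0
        else 1 + 28 * \<sigma> * D / lg * (1 - 1 / sqrt (card (Field E) / (\<sigma> * D))))"
      using layer_partition_of_few_arcs[OF E(2,1) _ assms D(6) \<open>1 \<le> r\<close> \<open>r \<le> L\<close> E(3) _ D(1) _ D(3)]
      unfolding lg_def by blast
    note t'
    also have "\<sigma> * D / r + 2 ^ r + (if card (Field E) < \<sigma> * D then 0
        else 1 + 28 * \<sigma> * D / lg * (1 - 1 / sqrt (card (Field E) / (\<sigma> * D))))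
      \<le> 4 * (\<sigma> * D / lg) + 2 * D powr (1/4) + (1 + 28 * (\<sigma> * D / lg))"
    proof (intro add_mono)
      have "\<sigma> * D / r \<le> \<sigma> * D / (lg / 4)"
        using r(1) lg D(6) assms by (intro divide_left_mono) auto
      then show "\<sigma> * D / r \<le> 4 * (\<sigma> * D / lg)" by (simp add: mult.commute)
      have "(2 :: real) ^ r = 2 powr real r" by (simp add: powr_realpow)
      also have "\<dots> \<le> 2 powr (lg / 4 + 1)" using r(2) by (intro powr_mono) auto
      also have "\<dots> = 2 * (2 powr lg) powr (1/4)" by (simp add: powr_add powr_powr)
      also have "2 powr lg = D" using D(6) by (simp add: lg_def)
      finally show "2 ^ r \<le> 2 * D powr (1/4)" .
      have pos: "0 \<le> 28 * (\<sigma> * D / lg)" using assms D(6) lg by simp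
      have "28 * (\<sigma> * D / lg) * (1 - 1 / sqrt (card (Field E) / (\<sigma> * D))) \<le> 28 * (\<sigma> * D / lg) * 1"
        using assms D(6) by (intro mult_left_mono pos) simp
      then show "(if card (Field E) < \<sigma> * D then 0
        else 1 + 28 * \<sigma> * D / lg * (1 - 1 / sqrt (card (Field E) / (\<sigma> * D))))
        \<le> 1 + 28 * (\<sigma> * D / lg)"
        using pos by (simp add: mult.assoc)
    qed
    \<comment> \<open>33 is 4 for the greedy phase, 28 for the extraction phase, and 1 for the
      lower-order terms.\<close>
    also have "\<dots> \<le> 33 * (\<sigma> * D / lg)"
    proof -
      have "4 * x + y + (1 + 28 * x) \<le> 33 * x" if "y + 1 \<le> x" for x y :: real
        using that by linarith
      from this[OF D(5)] show ?thesis unfolding lg_def .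
    qed
    finally show "\<exists>t L. layer_partition E (Field E) t L \<and> real L \<le> log 2 D \<and>
        real t \<le> 33 * \<sigma> * D / log 2 D"
      using t L(1) unfolding lg_def by (auto simp: mult.assoc)
  qed simp
qed

text \<open>With \<open>\<mu> = (log n)\<^bsup>1/(k+1)\<^esup>\<close> and \<open>D = n\<^sup>k \<mu>\<close>, layers are split along \<open>l \<approx> \<mu>\<close> steps per
  colour and classes along \<open>r \<approx> n / \<mu>\<close> steps, so that \<open>r\<^sup>k\<close> exceeds \<open>D / log D \<approx> (n / \<mu>)\<^sup>k\<close>.\<close>
lemma eventually_many_arcs:
  fixes k :: nat
  assumes "1 \<le> k"
  shows "\<exists>c>0. \<exists>n0\<ge>2. \<forall>n\<ge>n0. \<forall>G :: 'a pair_pre_digraph.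
    oriented_graph G \<longrightarrow> arrows G (directed_path n) (k + 1) \<longrightarrow>
    c * (real n ^ k * log 2 n powr (1 / real (k + 1)))\<^sup>2 < card (parcs G)"
proof -
  \<comment> \<open>Chosen so that \<open>2 * k * l \<le> K * \<mu>\<close> for the \<open>l\<close>
    below, one factor 2 coming from rounding \<open>l\<close> up.\<close>
  define K where "K = 4 * real k * real (k + 1)"
  have K: "8 \<le> K"
  proof -
    have "4 * 1 * 2 \<le> 4 * real k * real (k + 1)"
      using assms by (intro mult_mono) auto
    then show ?thesis by (simp add: K_def)
  qed
  \<comment> \<open>Turns the class bound \<open>33 * \<sigma> * D / lg\<close> into exactly
    \<open>(n / (K * \<mu>)) ^ k\<close>.\<close>
  define \<sigma> where "\<sigma> = 1 / (33 * K ^ k)"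
  have "0 < \<sigma>" using K by (simp add: \<sigma>_def)
  obtain D0 where D0: "\<forall>D\<ge>D0. \<forall>E :: ('a \<times> 'a) set. finite E \<longrightarrow> asym E \<longrightarrow>
      card E \<le> \<sigma>\<^sup>2 / 32 * D\<^sup>2 \<longrightarrow>
      (\<exists>t L. layer_partition E (Field E) t L \<and> real L \<le> log 2 D \<and> real t \<le> 33 * \<sigma> * D / log 2 D)"
    using eventually_layer_partition[OF \<open>0 < \<sigma>\<close>, where 'a = 'a] by (elim exE conjE) (rule that)
  have "0 < K" using K by simp
  then have "eventually (\<lambda>n. 2 * K * log 2 (real n) \<le> real n) at_top"
    by real_asymp
  moreover have "eventually (\<lambda>n. D0 \<le> real n) at_top"
    by real_asymp
  ultimately have "eventually (\<lambda>n. D0 \<le> real n \<and> 2 * K * log 2 (real n) \<le> real n) at_top"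
    by eventually_elim auto
  then obtain n1 where n1: "n1 \<le> n \<Longrightarrow> D0 \<le> real n \<and> 2 * K * log 2 (real n) \<le> real n" for n
    unfolding eventually_at_top_linorder by blast
  have "\<sigma>\<^sup>2 / 32 * (real n ^ k * log 2 n powr (1 / real (k + 1)))\<^sup>2 < card (parcs G)"
    if "max n1 2 \<le> n" and G: "oriented_graph G" "arrows G (directed_path n) (k + 1)"
    for n and G :: "'a pair_pre_digraph"
  proof (rule ccontr)
    define lg where "lg = log 2 n"
    define \<mu> where "\<mu> = lg powr (1 / real (k + 1))"
    define D where "D = real n ^ k * \<mu>"
    assume "\<not> ?thesis"
    then have few: "card (parcs G) \<le> \<sigma>\<^sup>2 / 32 * D\<^sup>2" by (simp add: D_def \<mu>_def lg_def)
    have n: "2 \<le> n" "D0 \<le> real n" "2 * K * lg \<le> real n"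
      using that(1) n1[of n] by (auto simp: lg_def)
    have "log 2 2 \<le> lg" unfolding lg_def using n(1) by (subst log_le_cancel_iff) auto
    then have lg: "1 \<le> lg" by simp
    have "1 \<le> \<mu>" using lg by (simp add: \<mu>_def ge_one_powr_ge_zero)
    have "\<mu> \<le> lg powr 1" unfolding \<mu>_def using lg by (intro powr_mono) auto
    then have "\<mu> \<le> lg" using lg by simp
    have \<mu>: "\<mu> ^ (k + 1) = lg"
    proof -
      have "\<mu> ^ (k + 1) = \<mu> powr real (k + 1)"
        using \<open>1 \<le> \<mu>\<close> by (intro powr_realpow[symmetric]) simp
      also have "\<dots> = lg powr (1 / real (k + 1) * real (k + 1))"
        unfolding \<mu>_def by (rule powr_powr)
      also have "1 / real (k + 1) * real (k + 1) = 1" by simp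
      finally show ?thesis using lg by simp
    qed
    have "lg \<le> n"
      using K n(3) lg by (intro order_trans[OF _ n(3)]) simp
    have "real n ^ 1 \<le> real n ^ k" using assms n(1) by (intro power_increasing) auto
    then have "real n * 1 \<le> D" unfolding D_def using \<open>1 \<le> \<mu>\<close> by (intro mult_mono) auto
    then have "n \<le> D" by simp
    then have "D0 \<le> D" using n by simp
    have lgD: "lg \<le> log 2 D" unfolding lg_def using \<open>n \<le> D\<close> n(1) by (subst log_le_cancel_iff) auto
    have "D \<le> real n ^ k * real n"
      unfolding D_def using \<open>\<mu> \<le> lg\<close> \<open>lg \<le> n\<close> by (intro mult_left_mono) auto
    then have "D \<le> real n ^ (k + 1)" by (simp add: mult.commute)
    then have "log 2 D \<le> log 2 (real n ^ (k + 1))"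
      using \<open>n \<le> D\<close> n(1) by (subst log_le_cancel_iff) auto
    also have "\<dots> = real (k + 1) * lg"
      using n(1) by (subst log_nat_power) (auto simp: lg_def)
    finally have lgD': "log 2 D \<le> real (k + 1) * lg" .
    obtain t L where part: "layer_partition (parcs G) (Field (parcs G)) t L"
      and L: "real L \<le> log 2 D" and t: "real t \<le> 33 * \<sigma> * D / log 2 D"
      using D0 \<open>D0 \<le> D\<close> finite_parcs[OF G(1)] asym_parcs[OF G(1)] few by blast
    define l where "l = nat \<lceil>real (k + 1) * \<mu>\<rceil>"
    have "1 \<le> real (k + 1) * \<mu>" using \<open>1 \<le> \<mu>\<close> by (intro mult_ge1_I) auto
    then have l: "real (k + 1) * \<mu> \<le> l" "real l \<le> 2 * (real (k + 1) * \<mu>)"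
      unfolding l_def by linarith+
    define r where "r = (n - 1) div (k * l)"
    have "0 < l" using l(1) \<open>1 \<le> real (k + 1) * \<mu>\<close> by (cases l) auto
    \<comment> \<open>The factor \<open>k + 1\<close> in \<open>l\<close> absorbs the passage from
      \<open>log 2 n\<close> to \<open>log 2 D\<close>.\<close>
    have "L \<le> l ^ (k + 1)"
    proof -
      have "real L \<le> real (k + 1) * lg" using L lgD' by simp
      also have "\<dots> \<le> real (k + 1) ^ (k + 1) * lg"
        using lg self_le_power[of "real (k + 1)" "k + 1"] by (intro mult_right_mono) auto
      also have "\<dots> = (real (k + 1) * \<mu>) ^ (k + 1)"
        by (simp only: power_mult_distrib \<mu>)
      also have "\<dots> \<le> real l ^ (k + 1)"
        using l(1) \<open>1 \<le> \<mu>\<close> by (intro power_mono) auto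
      finally show ?thesis by (metis of_nat_le_iff of_nat_power)
    qed
    moreover have "t \<le> r ^ k"
    proof -
      have kl: "real (k * l) * 2 \<le> K * \<mu>"
        using mult_left_mono[OF l(2), of "2 * real k"] by (simp add: K_def mult_ac)
      have "K * \<mu> * 2 \<le> n"
      proof -
        have "2 * K * \<mu> \<le> 2 * K * lg" using \<open>\<mu> \<le> lg\<close> K by (intro mult_left_mono) auto
        then show ?thesis using n(3) by linarith
      qed
      have "0 < k * l" using assms \<open>0 < l\<close> by simp
      have "real (n - 1) < (real r + 1) * real (k * l)"
      proof -
        have "n - 1 < Suc r * (k * l)"
          unfolding r_def using \<open>0 < k * l\<close> by (metis dividend_less_div_times mult.commute mult_Suc_right add.commute)
        then show ?thesis by (metis of_nat_less_iff of_nat_mult of_nat_Suc add.commute)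
      qed
      then have "real n \<le> (real r + 1) * real (k * l) + 1" using n(1) by simp
      also have "\<dots> \<le> (real r + 2) * real (k * l)"
      proof -
        have "1 \<le> real (k * l)" using \<open>0 < k * l\<close> by linarith
        then show ?thesis by (simp add: distrib_right)
      qed
      also have "\<dots> \<le> (real r + 2) * (K * \<mu> / 2)"
        using kl by (intro mult_left_mono) auto
      finally have "real n \<le> real r * (K * \<mu>) / 2 + K * \<mu>" by (simp add: algebra_simps)
      \<comment> \<open>The rounding loss \<open>K * \<mu>\<close> is at most half of
        \<open>n\<close>.\<close>
      then have "real n \<le> real r * (K * \<mu>) * 1"
        using \<open>K * \<mu> * 2 \<le> n\<close> by linarith
      moreover have "0 < K * \<mu>" using K \<open>1 \<le> \<mu>\<close> by simp
      ultimately have rn: "n / (K * \<mu>) \<le> r"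
        by (simp add: pos_divide_le_eq)
      have "33 * \<sigma> * D / log 2 D \<le> 33 * \<sigma> * D / lg"
        using lgD lg \<open>0 < \<sigma>\<close> \<open>n \<le> D\<close> by (intro divide_left_mono) auto
      \<comment> \<open>As \<open>lg = \<mu> ^ (k + 1)\<close>, the quotient \<open>D / lg\<close>
        equals \<open>(n / \<mu>) ^ k\<close>; this fixes the exponent of the logarithm.\<close>
      also have "\<dots> = (n / (K * \<mu>)) ^ k"
        using \<open>1 \<le> \<mu>\<close> by (simp add: \<mu>[symmetric] \<sigma>_def D_def power_divide power_mult_distrib)
      also have "\<dots> \<le> real r ^ k"
        using rn K \<open>1 \<le> \<mu>\<close> by (intro power_mono) auto
      finally have "real t \<le> real (r ^ k)" using t unfolding of_nat_power by linarith
      then show ?thesis by (simp only: of_nat_le_iff)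
    qed
    moreover have "k * r * l \<le> n - 1"
      unfolding r_def by (metis mult.assoc mult.commute div_times_less_eq_dividend)
    ultimately show False
      using not_arrows_of_layer_partition[OF part _ _ assms n(1)] G(2) by blast
  qed
  then show ?thesis
    using \<open>0 < \<sigma>\<close> by (intro exI[of _ "\<sigma>\<^sup>2 / 32"] conjI exI[of _ "max n1 2"] allI impI) auto
qed

theorem mainTheorem2:
  fixes k :: nat
  assumes "k \<ge> 1"
  shows "\<exists>c\<^sub>1 :: real. c\<^sub>1 > 0 \<and>
    (\<forall>n :: nat. n \<ge> 2 \<longrightarrow>
      real (oriented_size_ramsey (directed_path n) (k + 1)) \<ge>
        c\<^sub>1 * real n ^ (2 * k) * (log 2 (real n)) powr (2 / real (k + 1)))"
proof -
  obtain c n0 where "0 < c" "2 \<le> n0" and large: "\<And>n G :: nat pair_pre_digraph. n0 \<le> n \<Longrightarrow>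
      oriented_graph G \<Longrightarrow> arrows G (directed_path n) (k + 1) \<Longrightarrow>
      c * (real n ^ k * log 2 n powr (1 / real (k + 1)))\<^sup>2 < card (parcs G)"
    using eventually_many_arcs[OF assms, where 'a = nat] by blast
  define F where "F = (\<lambda>n :: nat. (real n ^ k * log 2 n powr (1 / real (k + 1)))\<^sup>2)"
  have F: "F n = real n ^ (2 * k) * log 2 n powr (2 / real (k + 1))" if "2 \<le> n" for n
    by (simp add: F_def power_mult_distrib power_mult[symmetric] mult.commute)
      (simp add: power2_eq_square powr_add[symmetric] add_divide_distrib[symmetric])
  have F_mono: "F n \<le> F m" if "2 \<le> n" "n \<le> m" for n m
    unfolding F_def using that by (intro power_mono mult_mono powr_mono2) auto
  have "0 < log 2 n0" using \<open>2 \<le> n0\<close> by simp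
  then have "log 2 n0 \<noteq> 0" by linarith
  then have "0 < F n0" using \<open>2 \<le> n0\<close> by (simp add: F_def)
  \<comment> \<open>Below \<open>n0\<close> monotonicity of \<open>F\<close> makes the left side at
    most 1, so a single arc suffices.\<close>
  have "min c (1 / F n0) * F n \<le> oriented_size_ramsey (directed_path n) (k + 1)" if "2 \<le> n" for n
  proof -
    obtain G :: "nat pair_pre_digraph" where G: "oriented_graph G"
      "card (parcs G) = oriented_size_ramsey (directed_path n) (k + 1)"
      "arrows G (directed_path n) (k + 1)"
      by (rule oriented_size_ramsey_attained)
    show ?thesis
    proof (cases "n0 \<le> n")
      case True
      have "min c (1 / F n0) * F n \<le> c * F n"
        by (intro mult_right_mono) (auto simp: F_def)
      also have "\<dots> < card (parcs G)" using large[OF True G(1,3)] by (simp add: F_def)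
      finally show ?thesis using G(2) by simp
    next
      case False
      have "min c (1 / F n0) * F n \<le> 1 / F n0 * F n0"
        using False F_mono[OF that, of n0] \<open>0 < F n0\<close> by (intro mult_mono) (auto simp: F_def)
      also have "\<dots> = 1" using \<open>0 < F n0\<close> by simp
      also have "1 \<le> real (card (parcs G))"
        using arrows_imp_arcs[OF G(1) _ that, of k] G(3) by simp
      finally show ?thesis using G(2) by simp
    qed
  qed
  then show ?thesis
    using F \<open>0 < c\<close> \<open>0 < F n0\<close>
    by (intro exI[of _ "min c (1 / F n0)"]) (simp add: mult.assoc)
qed

end
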